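(* Let $\mathcal X\subset\mathbb R^n$ be a nonempty convex compact set and $f:\mathcal X\to\mathbb R$ a continuously differentiable convex function with $\mathcal K$-representable epigraph $$\{(x,s): s\geq f(x),\ x\in\mathcal X\}=\{(x,s):\exists u: Ax+sp+Qu\leq_{\mathbf K}a\}\qquad[\mathbf K\in\mathcal K],$$ the representation being essentially strictly feasible. Then the conic constraint $$t\geq s+r,\quad Ax+sp+Qu\leq_{\mathbf K}a,\quad r\geq a^T\lambda,\quad A^T\lambda=g,\quad p^T\lambda=-1,\quad Q^T\lambda=0,\quad\lambda\geq_{\mathbf K^*}0$$ in variables $t,g,x$ and additional variables $s,r,\lambda,u$ is a $\mathcal K$-representation of $(F,\mathcal X)$ with $F(\cdot)=f'(\cdot)$ the gradient field of $f$.
   Context: $\mathcal K$ is a fixed family of regular cones (closed, convex, pointed, with nonempty interior) in Euclidean spaces which contains $\mathbb R_+$, is closed under finite direct products, and is closed under passing from a cone $\mathbf K$ to its dual $\mathbf K^*$. $a\leq_{\mathbf K}b$ means $b-a\in\mathbf K$. A $\mathcal K$-conic constraint is a constraint $Ax\leq_{\mathbf K}a$ with $\mathbf K\in\mathcal K$; finite systems of such constraints, linear equalities and nonstrict linear inequalities are equivalent to a single such constraint. A conic constraint $Ax\leq_{\mathbf K}a$ is essentially strictly feasible if $\mathbf K=\mathbb R^m_+\times\mathbf L$ with regular $\mathbf L$ (either factor may be absent), so that it reads $Px\leq p$, $Qx\leq_{\mathbf L}q$, and there is $\bar x$ with $P\bar x\leq p$ and $q-Q\bar x\in\operatorname{int}\mathbf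 L$; for a representation of a set this refers to the representing constraint in all its variables. Continuous differentiability of $f$ on $\mathcal X$: there is a continuous gradient field $f':\mathcal X\to\mathbb R^n$ with $f(y)=f(x)+f'(x)^T(y-x)+o(\|y-x\|)$ as $y\to x$, $y\in\mathcal X$, for every $x\in\mathcal X$. Let $\mathcal X$ be a nonempty convex subset of a Euclidean space $E$. A vector field $F:\mathcal X\to E$ is monotone if $\langle F(x)-F(y),x-y\rangle\geq0$ for all $x,y\in\mathcal X$. For continuous monotone $F$ put $$\mathcal F[F,\mathcal X]=\{[t;g;x]\in\mathbb R\times E\times E: x\in\mathcal X,\ t-\langle g,y\rangle\geq\langle F(y),x-y\rangle\ \forall y\in\mathcal X\}.$$ A conic constraint $Xx+Gg+tT+Uu\leq_{\mathbf K}a$, $\mathbf K\in\mathcal K$ (or an equivalent finite system), in variables $t,g,x$ and additional variables $u$, with projection $\mathcal T$ of its solution set on the space of $[t;g;x]$, is a $\mathcal K$-representation of $(F,\mathcal X)$ if (i) $\mathcal T\subset\mathcal F[F,\mathcal X]$ and $[t;g;x]\in\mathcal T$, $t'\geq t$ imply $[t';g;x]\in\mathcal T$; and (ii) $\mathcal T\supset\{[\langle F(x),x\rangle;F(x);x]:x\in\mathcal X\}$. *)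

theory Defs
  imports "HOL-Analysis.Analysis" "HOL-Library.Function_Algebras"
begin

text \<open>
  Cones of different dimensions have to live in one type, so \<open>\<real>\<^sup>m\<close> is rendered as
  the carrier of the library space \<^const>\<open>Euclidean_space\<close>: the sequences
  \<open>nat \<Rightarrow> real\<close> vanishing from index \<open>m\<close> on. Its topology is the usual one. The pointwise
  vector space structure below makes the library notions \<open>convex\<close> and \<open>convex_cone\<close> available.
\<close>

instantiation "fun" :: (type, real_vector) real_vector
begin

definition scaleR_fun :: "real \<Rightarrow> ('a \<Rightarrow> 'b) \<Rightarrow> 'a \<Rightarrow> 'b" where
  "scaleR_fun c f = (\<lambda>x. c *\<^sub>R f x)"

instance
  by standard (simp_all add: scaleR_fun_def fun_eq_iff algebra_simps)

end

lemma scaleR_fun_apply [simp]: "(c *\<^sub>R f) x = c *\<^sub>R f x"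
  by (simp add: scaleR_fun_def)

type_synonym rvec = "nat \<Rightarrow> real"

abbreviation Rvec :: "nat \<Rightarrow> rvec set" where
  "Rvec m \<equiv> topspace (Euclidean_space m)"

definition dotp :: "nat \<Rightarrow> rvec \<Rightarrow> rvec \<Rightarrow> real" where
  "dotp m x y = (\<Sum>i<m. x i * y i)"

text \<open>\<open>vcat m x y\<close> is the column \<open>[x; y]\<close> with \<open>x \<in> \<real>\<^sup>m\<close>; \<open>vsingle c\<close> is \<open>[c] \<in> \<real>\<^sup>1\<close>.\<close>

definition vcat :: "nat \<Rightarrow> rvec \<Rightarrow> rvec \<Rightarrow> rvec" where
  "vcat m x y = (\<lambda>i. if i < m then x i else y (i - m))"

definition vsingle :: "real \<Rightarrow> rvec" where
  "vsingle c = (\<lambda>i. if i = 0 then c else 0)"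

text \<open>
  Matrices with \<open>m\<close> rows acting on a typed Euclidean space are given by their rows
  \<open>A 0, \<dots>, A (m - 1)\<close>; \<open>m \<times> k\<close> matrices acting on \<open>\<real>\<^sup>k\<close> by their entries \<open>Q i j\<close>,
  \<open>i < m\<close>, \<open>j < k\<close>.
\<close>

definition rows_mult :: "nat \<Rightarrow> (nat \<Rightarrow> 'a::euclidean_space) \<Rightarrow> 'a \<Rightarrow> rvec" where
  "rows_mult m A x = (\<lambda>i. if i < m then A i \<bullet> x else 0)"

definition rows_tmult :: "nat \<Rightarrow> (nat \<Rightarrow> 'a::euclidean_space) \<Rightarrow> rvec \<Rightarrow> 'a" where
  "rows_tmult m A y = (\<Sum>i<m. y i *\<^sub>R A i)"

definition mat_mult :: "nat \<Rightarrow> nat \<Rightarrow> (nat \<Rightarrow> nat \<Rightarrow> real) \<Rightarrow> rvec \<Rightarrow> rvec" where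
  "mat_mult m k Q u = (\<lambda>i. if i < m then \<Sum>j<k. Q i j * u j else 0)"

definition mat_tmult :: "nat \<Rightarrow> nat \<Rightarrow> (nat \<Rightarrow> nat \<Rightarrow> real) \<Rightarrow> rvec \<Rightarrow> rvec" where
  "mat_tmult m k Q y = mat_mult k m (\<lambda>j i. Q i j) y"


definition regular_cone :: "nat \<Rightarrow> rvec set \<Rightarrow> bool" where
  "regular_cone m K \<longleftrightarrow>
     closedin (Euclidean_space m) K \<and> convex_cone K \<and> K \<inter> uminus ` K = {0} \<and>
     Euclidean_space m interior_of K \<noteq> {}"

definition orthant :: "nat \<Rightarrow> rvec set" where
  "orthant m = {x \<in> Rvec m. \<forall>i<m. 0 \<le> x i}"

definition dual_cone :: "nat \<Rightarrow> rvec set \<Rightarrow> rvec set" where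
  "dual_cone m K = {y \<in> Rvec m. \<forall>x\<in>K. 0 \<le> dotp m y x}"

definition cone_prod :: "nat \<Rightarrow> rvec set \<Rightarrow> rvec set \<Rightarrow> rvec set" where
  "cone_prod m K L = {vcat m x y | x y. x \<in> K \<and> y \<in> L}"

text \<open>\<open>KK m\<close> is the set of those cones of the family which lie in \<open>\<real>\<^sup>m\<close>.\<close>

definition cone_family :: "(nat \<Rightarrow> rvec set set) \<Rightarrow> bool" where
  "cone_family KK \<longleftrightarrow>
     (\<forall>m. \<forall>K\<in>KK m. regular_cone m K) \<and>
     orthant 1 \<in> KK 1 \<and>
     (\<forall>m l. \<forall>K\<in>KK m. \<forall>L\<in>KK l. cone_prod m K L \<in> KK (m + l)) \<and>
     (\<forall>m. \<forall>K\<in>KK m. dual_cone m K \<in> KK m)"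

definition cone_le :: "rvec set \<Rightarrow> rvec \<Rightarrow> rvec \<Rightarrow> bool" where
  "cone_le K b a \<longleftrightarrow> a - b \<in> K"

text \<open>
  Essential strict feasibility of the constraint \<open>B v \<le>\<^sub>K a\<close> in the variable \<open>v\<close> ranging over
  \<open>V\<close>. The slack \<open>a - B v\<close> is \<open>[p - P v; q - Q v]\<close> in the splitting \<open>K = \<real>\<^sup>j\<^sub>+ \<times> L\<close>; an
  absent factor is the case \<open>j = 0\<close> or \<open>l = 0\<close>.
\<close>

definition ess_strictly_feasible ::
    "nat \<Rightarrow> rvec set \<Rightarrow> 'v set \<Rightarrow> ('v \<Rightarrow> rvec) \<Rightarrow> rvec \<Rightarrow> bool" where
  "ess_strictly_feasible m K V B a \<longleftrightarrow>
     (\<exists>j l L. m = j + l \<and> regular_cone l L \<and> K = cone_prod j (orthant j) L \<and>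
        (\<exists>v\<in>V. \<exists>y\<in>orthant j. \<exists>z\<in>Euclidean_space l interior_of L. a - B v = vcat j y z))"

definition gradient_field ::
    "'a::euclidean_space set \<Rightarrow> ('a \<Rightarrow> real) \<Rightarrow> ('a \<Rightarrow> 'a) \<Rightarrow> bool" where
  "gradient_field X f F \<longleftrightarrow>
     continuous_on X F \<and> (\<forall>x\<in>X. (f has_derivative (\<lambda>h. F x \<bullet> h)) (at x within X))"

definition monotone_field :: "'a::euclidean_space set \<Rightarrow> ('a \<Rightarrow> 'a) \<Rightarrow> bool" where
  "monotone_field X F \<longleftrightarrow> (\<forall>x\<in>X. \<forall>y\<in>X. 0 \<le> (F x - F y) \<bullet> (x - y))"

definition FF :: "('a::euclidean_space \<Rightarrow> 'a) \<Rightarrow> 'a set \<Rightarrow> (real \<times> 'a \<times> 'a) set" where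
  "FF F X = {(t, g, x). x \<in> X \<and> (\<forall>y\<in>X. t - g \<bullet> y \<ge> F y \<bullet> (x - y))}"

text \<open>
  \<open>S\<close> is the solution set of a single conic constraint \<open>Xx + Gg + tT + Uu \<le>\<^sub>K a\<close>, \<open>K\<close> in the
  family, in the variables \<open>t, g, x\<close> and \<open>u \<in> \<real>\<^sup>k\<close>. A finite system is admitted by way of its
  solution set, i.e. if it is equivalent, in the same variables, to a single such constraint.
\<close>

definition conic_constraint_set ::
    "(nat \<Rightarrow> rvec set set) \<Rightarrow> nat \<Rightarrow> (real \<times> 'a::euclidean_space \<times> 'a \<times> rvec) set \<Rightarrow> bool" where
  "conic_constraint_set KK k S \<longleftrightarrow>
     (\<exists>m K M G T U a. K \<in> KK m \<and> T \<in> Rvec m \<and> a \<in> Rvec m \<and>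
        S = {(t, g, x, u). u \<in> Rvec k \<and>
               cone_le K (rows_mult m M x + rows_mult m G g + t *\<^sub>R T + mat_mult m k U u) a})"

definition K_representation ::
    "(nat \<Rightarrow> rvec set set) \<Rightarrow> nat \<Rightarrow> (real \<times> 'a::euclidean_space \<times> 'a \<times> rvec) set \<Rightarrow>
     ('a \<Rightarrow> 'a) \<Rightarrow> 'a set \<Rightarrow> bool" where
  "K_representation KK k S F X \<longleftrightarrow>
     X \<noteq> {} \<and> convex X \<and> continuous_on X F \<and> monotone_field X F \<and>
     conic_constraint_set KK k S \<and>
     (let TT = {(t, g, x). \<exists>u. (t, g, x, u) \<in> S} in
        TT \<subseteq> FF F X \<and>
        (\<forall>t g x t'. (t, g, x) \<in> TT \<longrightarrow> t \<le> t' \<longrightarrow> (t', g, x) \<in> TT) \<and>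
        {(F x \<bullet> x, F x, x) | x. x \<in> X} \<subseteq> TT)"

end

theory Submission
  imports Defs
begin

text \<open>
  If \<open>(x, s)\<close> lies in the epigraph and \<open>\<lambda>\<close> is feasible for the dual part, pairing \<open>\<lambda>\<close> with the slack
  at a point \<open>(y, f y)\<close> gives \<open>r \<ge> g \<bullet> y - f y\<close>; together with \<open>f x - f y \<ge> F y \<bullet> (x - y)\<close> this
  is condition (i). For (ii), convexity makes \<open>x\<close> a minimizer over the epigraph of
  \<open>s - F x \<bullet> y\<close>, with value \<open>f x - F x \<bullet> x\<close>, and a multiplier attaining this value is the
  required \<open>\<lambda>\<close>. Such a multiplier exists by conic duality under the partial Slater condition: the
  multiplier of the non-polyhedral factor \<open>L\<close> comes from a Hahn-Banach argument, in which
  the polyhedral constraints restrict the domain, and the remaining multipliers come from the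
  Farkas lemma.
\<close>

section \<open>Farkas lemma for finitely many linear functionals on a real vector space\<close>

text \<open>
  Bartl's induction: if the last functional cannot be dropped, some \<open>y\<close> violates the implication
  without it, and one projects along \<open>y\<close> onto the kernel of the last functional.
\<close>

lemma linear_farkas:
  fixes \<phi> :: "nat \<Rightarrow> 'v::real_vector \<Rightarrow> real"
  assumes "\<And>i. i < n \<Longrightarrow> linear (\<phi> i)" "linear \<psi>"
    and "\<And>x. (\<And>i. i < n \<Longrightarrow> 0 \<le> \<phi> i x) \<Longrightarrow> 0 \<le> \<psi> x"
  shows "\<exists>\<mu>. (\<forall>i<n. 0 \<le> \<mu> i) \<and> (\<forall>x. \<psi> x = (\<Sum>i<n. \<mu> i * \<phi> i x))"
  using assms
proof (induction n arbitrary: \<phi> \<psi>)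
  case 0
  have "\<psi> x = 0" for x
    using 0(3)[of x] 0(3)[of "-x"] linear_neg[OF 0(2), of x] by simp
  then show ?case by simp
next
  case (Suc n)
  show ?case
  proof (cases "\<forall>x. (\<forall>i<n. 0 \<le> \<phi> i x) \<longrightarrow> 0 \<le> \<psi> x")
    case True
    then obtain \<mu> where \<mu>: "\<forall>i<n. 0 \<le> \<mu> i" "\<forall>x. \<psi> x = (\<Sum>i<n. \<mu> i * \<phi> i x)"
      using Suc.IH[of \<phi> \<psi>] Suc.prems by (metis less_SucI)
    then show ?thesis
      by (intro exI[of _ "\<mu>(n := 0)"]) (auto simp: less_Suc_eq)
  next
    case False
    then obtain y0 where y0: "\<And>i. i < n \<Longrightarrow> 0 \<le> \<phi> i y0" "\<psi> y0 < 0"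
      by (auto simp: not_le)
    \<comment> \<open>Otherwise \<open>y0\<close> would satisfy all \<open>Suc n\<close>
      inequalities, contradicting \<open>\<psi> y0 < 0\<close>.\<close>
    have neg: "\<phi> n y0 < 0"
      using Suc.prems(3)[of y0] y0 by (metis less_SucE not_le)
    \<comment> \<open>The scaling makes \<open>\<phi> n y = -1\<close>, so that adding
      \<open>\<phi> n x *\<^sub>R y\<close> to \<open>x\<close> cancels the value of
      \<open>\<phi> n\<close>.\<close>
    define y where "y = (inverse (- \<phi> n y0)) *\<^sub>R y0"
    have lin: "linear (\<phi> i)" if "i < Suc n" for i
      using Suc.prems(1) that by blast
    have "\<phi> n y = inverse (- \<phi> n y0) * \<phi> n y0"
      unfolding y_def by (rule linear_scale[OF lin, unfolded real_scaleR_def]) simp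
    then have y1: "\<phi> n y = -1" using neg by simp
    have y2: "\<psi> y < 0"
      using y0 neg by (simp add: y_def linear_scale[OF Suc.prems(2)] mult_less_0_iff del: inverse_minus_eq)
    have y3: "0 \<le> \<phi> i y" if "i < n" for i
      using that y0 neg by (simp add: y_def linear_scale[OF lin] zero_le_mult_iff del: inverse_minus_eq)
    note y = y1 y2 y3
    define pr where "pr x = x + \<phi> n x *\<^sub>R y" for x
    have pr: "linear pr"
      by (rule linearI) (simp_all add: pr_def linear_add[OF lin] linear_scale[OF lin] algebra_simps)
    have "\<exists>\<mu>. (\<forall>i<n. 0 \<le> \<mu> i) \<and> (\<forall>x. (\<psi> \<circ> pr) x = (\<Sum>i<n. \<mu> i * (\<phi> i \<circ> pr) x))"
    proof (rule Suc.IH)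
      show "linear (\<phi> i \<circ> pr)" if "i < n" for i
        using that by (intro linear_compose pr lin) simp
      show "linear (\<psi> \<circ> pr)"
        by (intro linear_compose pr Suc.prems)
      fix x assume *: "\<And>i. i < n \<Longrightarrow> 0 \<le> (\<phi> i \<circ> pr) x"
      have "\<phi> n (pr x) = 0"
        by (simp add: pr_def linear_add[OF lin] linear_scale[OF lin] y)
      with * show "0 \<le> (\<psi> \<circ> pr) x"
        unfolding o_def by (intro Suc.prems(3)) (metis less_SucE order_refl)
    qed
    then obtain \<mu> where \<mu>: "\<And>i. i < n \<Longrightarrow> 0 \<le> \<mu> i"
      "\<And>x. \<psi> (pr x) = (\<Sum>i<n. \<mu> i * \<phi> i (pr x))" by auto
    \<comment> \<open>Expanding the identity for \<open>\<psi> (pr x)\<close> and collecting the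
      terms with \<open>\<phi> n x\<close> leaves exactly this coefficient. It is nonnegative
      because \<open>y\<close> satisfies the first \<open>n\<close> inequalities while
      \<open>\<psi> y < 0\<close>.\<close>
    define \<nu> where "\<nu> = (\<Sum>i<n. \<mu> i * \<phi> i y) - \<psi> y"
    have "0 \<le> (\<Sum>i<n. \<mu> i * \<phi> i y)"
      by (intro sum_nonneg) (simp add: \<mu> y)
    then have "0 \<le> \<nu>" using y by (simp add: \<nu>_def)
    moreover have "\<psi> x = (\<Sum>i<n. \<mu> i * \<phi> i x) + \<nu> * \<phi> n x" for x
    proof -
      have "\<psi> x + \<phi> n x * \<psi> y = (\<Sum>i<n. \<mu> i * (\<phi> i x + \<phi> n x * \<phi> i y))"
        using \<mu>(2)[of x] unfolding pr_def
        by (simp add: linear_add[OF lin] linear_scale[OF lin] linear_add[OF Suc.prems(2)] linear_scale[OF Suc.prems(2)])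
      then show ?thesis
        by (simp add: \<nu>_def algebra_simps sum.distrib sum_distrib_left)
    qed
    ultimately show ?thesis
      using \<mu> by (intro exI[of _ "\<mu>(n := \<nu>)"]) (auto simp: less_Suc_eq)
  qed
qed

section \<open>Coordinates: inner product, product cones, interior points\<close>

lemma mem_Rvec: "x \<in> Rvec m \<longleftrightarrow> (\<forall>i\<ge>m. x i = 0)"
  by (auto simp: Euclidean_space_def)

lemma regular_cone_subset_Rvec: "regular_cone m K \<Longrightarrow> K \<subseteq> Rvec m"
  unfolding regular_cone_def by (blast dest: closedin_subset)

lemma dotp_add_right: "dotp m x (y + z) = dotp m x y + dotp m x z"
  by (simp add: dotp_def sum.distrib algebra_simps)

lemma dotp_diff_right: "dotp m x (y - z) = dotp m x y - dotp m x z"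
  by (simp add: dotp_def sum_subtractf algebra_simps)

lemma dotp_scaleR_right: "dotp m x (c *\<^sub>R y) = c * dotp m x y"
  by (simp add: dotp_def sum_distrib_left algebra_simps)

lemma dotp_zero_right [simp]: "dotp m x 0 = 0"
  by (simp add: dotp_def)

lemma dotp_zero_left [simp]: "dotp m 0 x = 0"
  by (simp add: dotp_def)

lemma dotp_commute: "dotp m x y = dotp m y x"
  by (simp add: dotp_def mult.commute)

lemma dotp_append:
  "dotp (m + l) x y = dotp m x y + dotp l (\<lambda>i. x (m + i)) (\<lambda>i. y (m + i))"
proof -
  have "(\<Sum>i<m + l. x i * y i) = (\<Sum>i<m. x i * y i) + (\<Sum>i=m..<m + l. x i * y i)"
    by (subst sum.union_disjoint[symmetric]) (auto intro!: sum.cong)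
  also have "(\<Sum>i=m..<m + l. x i * y i) = (\<Sum>i<l. x (m + i) * y (m + i))"
    by (rule sum.reindex_bij_witness[of _ "\<lambda>i. m + i" "\<lambda>i. i - m"]) auto
  finally show ?thesis by (simp add: dotp_def)
qed

text \<open>A vector of \<open>Rvec m\<close> is determined by its first \<open>m\<close> entries,
  so truncating \<open>w\<close> recovers the first factor. The inclusion of \<open>K\<close> rules
  out entries beyond \<open>m\<close>, which \<open>vcat\<close> would discard.\<close>

lemma mem_cone_prod:
  assumes "K \<subseteq> Rvec m"
  shows "w \<in> cone_prod m K L \<longleftrightarrow> (\<lambda>i. if i < m then w i else 0) \<in> K \<and> (\<lambda>i. w (m + i)) \<in> L"
proof
  assume "w \<in> cone_prod m K L"
  then obtain x y where w: "w = vcat m x y" "x \<in> K" "y \<in> L"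
    by (auto simp: cone_prod_def)
  then have "(\<lambda>i. if i < m then w i else 0) = x"
    using assms by (auto simp: vcat_def fun_eq_iff mem_Rvec subset_iff)
  moreover have "(\<lambda>i. w (m + i)) = y"
    using w by (auto simp: vcat_def)
  ultimately show "(\<lambda>i. if i < m then w i else 0) \<in> K \<and> (\<lambda>i. w (m + i)) \<in> L"
    using w by simp
next
  assume *: "(\<lambda>i. if i < m then w i else 0) \<in> K \<and> (\<lambda>i. w (m + i)) \<in> L"
  have "w = vcat m (\<lambda>i. if i < m then w i else 0) (\<lambda>i. w (m + i))"
    by (auto simp: vcat_def)
  with * show "w \<in> cone_prod m K L"
    unfolding cone_prod_def by blast
qed

lemma mem_cone_prod_orthant:
  "w \<in> cone_prod j (orthant j) L \<longleftrightarrow> (\<forall>i<j. 0 \<le> w i) \<and> (\<lambda>i. w (j + i)) \<in> L"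
  by (subst mem_cone_prod) (auto simp: orthant_def mem_Rvec)

text \<open>The line \<open>z - \<epsilon> *\<^sub>R y\<close> starts in the interior at
  \<open>\<epsilon> = 0\<close> and, by continuity, is still in \<open>L\<close> for some
  \<open>\<epsilon> > 0\<close>; multiply by \<open>\<tau> = 1 / \<epsilon>\<close>.\<close>

lemma interior_of_cone_absorbing:
  assumes "convex_cone L" "z \<in> Euclidean_space l interior_of L" "y \<in> Rvec l"
  shows "\<exists>\<tau>>0. \<tau> *\<^sub>R z - y \<in> L"
proof -
  define U where "U = Euclidean_space l interior_of L"
  define h :: "real \<Rightarrow> rvec" where "h \<epsilon> = z - \<epsilon> *\<^sub>R y" for \<epsilon>
  have "z \<in> Rvec l"
    by (rule subsetD[OF interior_of_subset_topspace assms(2)])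
  then have "continuous_map euclideanreal (Euclidean_space l) h"
    using assms(3) unfolding Euclidean_space_def
    by (auto simp: h_def continuous_map_in_subtopology continuous_map_componentwise_UNIV
        intro!: continuous_intros)
  then have "openin euclideanreal {\<epsilon> \<in> topspace euclideanreal. h \<epsilon> \<in> U}"
    by (rule openin_continuous_map_preimage) (simp add: U_def)
  then have "open {\<epsilon>. h \<epsilon> \<in> U}" by simp
  moreover have "0 \<in> {\<epsilon>. h \<epsilon> \<in> U}"
    using assms(2) by (simp add: h_def U_def)
  ultimately obtain d where d: "d > 0" "ball 0 d \<subseteq> {\<epsilon>. h \<epsilon> \<in> U}"
    using open_contains_ball by blast
  then have "d / 2 \<in> {\<epsilon>. h \<epsilon> \<in> U}"
    by (intro subsetD[OF d(2)]) (simp add: dist_norm)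
  then have "h (d / 2) \<in> L"
    using subsetD[OF interior_of_subset] by (simp add: U_def)
  then have "(2 / d) *\<^sub>R h (d / 2) \<in> L"
    using convex_cone_scaleR[OF assms(1)] d(1) by simp
  moreover have "(2 / d) *\<^sub>R h (d / 2) = (2 / d) *\<^sub>R z - y"
    using d(1) by (simp add: h_def scaleR_diff_right)
  ultimately show ?thesis using d(1) by (intro exI[of _ "2 / d"]) simp
qed

section \<open>Hahn-Banach domination, one coordinate at a time\<close>

text \<open>
  This is Hahn-Banach domination for the sublinear function \<open>z \<mapsto> Inf {\<rho>. (\<rho>, z) \<in> G}\<close>, stated for
  the cone \<open>G\<close> so that the infimum need not be formed.
\<close>

lemma cone_supporting_functional:
  fixes G :: "(real \<times> rvec) set"
  assumes "\<And>v w. v \<in> G \<Longrightarrow> w \<in> G \<Longrightarrow> v + w \<in> G"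
    and "\<And>v c. v \<in> G \<Longrightarrow> 0 < c \<Longrightarrow> c *\<^sub>R v \<in> G"
    and "\<And>z. z \<in> Rvec l \<Longrightarrow> \<exists>\<rho>. (\<rho>, z) \<in> G"
    and "\<And>\<rho>. (\<rho>, 0) \<in> G \<Longrightarrow> 0 \<le> \<rho>"
  shows "\<exists>lam\<in>Rvec l. \<forall>\<rho> z. (\<rho>, z) \<in> G \<longrightarrow> z \<in> Rvec l \<longrightarrow> dotp l lam z \<le> \<rho>"
  using assms
proof (induction l arbitrary: G)
  case 0
  have "z = 0" if "z \<in> Rvec 0" for z
    using that by (auto simp: mem_Rvec)
  then show ?case
    using 0(4) by (intro bexI[of _ 0]) (auto simp: dotp_def mem_Rvec)
next
  case (Suc l)
  note add = Suc.prems(1) and scale = Suc.prems(2)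
  define e :: rvec where "e = (\<lambda>i. if i = l then 1 else 0)"
  have eR: "e \<in> Rvec (Suc l)" "- e \<in> Rvec (Suc l)"
    by (auto simp: e_def mem_Rvec)
  define P where "P = {\<rho>. (\<rho>, e) \<in> G}"
  define N where "N = {\<rho>. (\<rho>, -e) \<in> G}"
  have ne: "P \<noteq> {}" "N \<noteq> {}"
    unfolding P_def N_def using Suc.prems(3)[OF eR(1)] Suc.prems(3)[OF eR(2)] by blast+
  \<comment> \<open>Elements of \<open>G\<close> over \<open>e\<close> and \<open>-e\<close> add up
    to one over \<open>0\<close>. Hence every \<open>-\<sigma>\<close> with \<open>\<sigma>\<close>
    in \<open>N\<close> lies below all of \<open>P\<close>.\<close>
  have PN: "0 \<le> \<rho> + \<sigma>" if "\<rho> \<in> P" "\<sigma> \<in> N" for \<rho> \<sigma>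
  proof (rule Suc.prems(4))
    show "(\<rho> + \<sigma>, 0) \<in> G"
      using add[of "(\<rho>, e)" "(\<sigma>, -e)"] that by (simp add: P_def N_def)
  qed
  \<comment> \<open>The value of the functional at \<open>e\<close>. Any number separating the
    \<open>-\<sigma>\<close> from \<open>P\<close> would serve; the infimum of \<open>P\<close> is
    one.\<close>
  define \<alpha> where "\<alpha> = Inf P"
  obtain \<sigma>0 where "\<sigma>0 \<in> N" using ne by blast
  then have bdd: "bdd_below P"
    using PN by (intro bdd_belowI[of _ "- \<sigma>0"]) (auto dest: PN)
  have aP: "\<alpha> \<le> \<rho>" if "\<rho> \<in> P" for \<rho>
    unfolding \<alpha>_def using that bdd by (rule cInf_lower)
  have aN: "- \<sigma> \<le> \<alpha>" if "\<sigma> \<in> N" for \<sigma>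
    unfolding \<alpha>_def using ne PN[OF _ that] by (intro cInf_greatest) (auto simp: minus_le_iff dest: PN[OF _ that])
  have line: "\<alpha> * t \<le> \<rho>" if "(\<rho>, t *\<^sub>R e) \<in> G" for \<rho> t
  proof -
    consider "t = 0" | "t > 0" | "t < 0" by linarith
    then show ?thesis
    proof cases
      case 1
      then have "(\<rho>, 0) \<in> G" using that by simp
      with 1 show ?thesis using Suc.prems(4) by (metis mult_zero_right)
    next
      case 2
      with scale[OF that, of "1 / t"] have "\<rho> / t \<in> P" by (simp add: P_def)
      from aP[OF this] 2 show ?thesis by (simp add: field_simps)
    next
      case 3
      with scale[OF that, of "1 / -t"] have "\<rho> / -t \<in> N" by (simp add: N_def)
      from aN[OF this] 3 show ?thesis by (simp add: field_simps)
    qed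
  qed
  \<comment> \<open>The coordinate along \<open>e\<close> is eliminated after subtracting the value
    \<open>\<alpha> * t\<close> already fixed for it. The sign condition over \<open>0\<close> for
    \<open>G'\<close> then reduces to \<open>line\<close>.\<close>
  define G' where "G' = {(\<rho>, z). \<exists>t. (\<rho> + \<alpha> * t, z + t *\<^sub>R e) \<in> G}"
  have "\<exists>lam\<in>Rvec l. \<forall>\<rho> z. (\<rho>, z) \<in> G' \<longrightarrow> z \<in> Rvec l \<longrightarrow> dotp l lam z \<le> \<rho>"
  proof (rule Suc.IH)
    show "v + w \<in> G'" if vw: "v \<in> G'" "w \<in> G'" for v w
    proof -
      obtain t u where "(fst v + \<alpha> * t, snd v + t *\<^sub>R e) \<in> G" "(fst w + \<alpha> * u, snd w + u *\<^sub>R e) \<in> G"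
        using vw by (auto simp: G'_def)
      from add[OF this] have "(fst (v + w) + \<alpha> * (t + u), snd (v + w) + (t + u) *\<^sub>R e) \<in> G"
        by (simp add: algebra_simps)
      then show ?thesis by (auto simp: G'_def case_prod_beta)
    qed
    show "c *\<^sub>R v \<in> G'" if v: "v \<in> G'" "0 < c" for v c
    proof -
      obtain t where "(fst v + \<alpha> * t, snd v + t *\<^sub>R e) \<in> G"
        using v by (auto simp: G'_def)
      from scale[OF this v(2)] have "(fst (c *\<^sub>R v) + \<alpha> * (c * t), snd (c *\<^sub>R v) + (c * t) *\<^sub>R e) \<in> G"
        by (simp add: algebra_simps)
      then show ?thesis by (auto simp: G'_def case_prod_beta)
    qed
    show "\<exists>\<rho>. (\<rho>, z) \<in> G'" if "z \<in> Rvec l" for z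
    proof -
      have "z \<in> Rvec (Suc l)" using that by (simp add: mem_Rvec)
      then obtain \<rho> where "(\<rho>, z) \<in> G" using Suc.prems(3) by blast
      then have "(\<rho>, z) \<in> G'" by (auto simp: G'_def intro!: exI[of _ 0])
      then show ?thesis ..
    qed
    show "0 \<le> \<rho>" if \<rho>: "(\<rho>, 0) \<in> G'" for \<rho>
    proof -
      obtain t where "(\<rho> + \<alpha> * t, 0 + t *\<^sub>R e) \<in> G"
        using \<rho> unfolding G'_def by blast
      then show ?thesis using line[of "\<rho> + \<alpha> * t" t] by simp
    qed
  qed
  then obtain lam where lam: "lam \<in> Rvec l"
    "\<And>\<rho> z. (\<rho>, z) \<in> G' \<Longrightarrow> z \<in> Rvec l \<Longrightarrow> dotp l lam z \<le> \<rho>" by blast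
  show ?case
  proof (intro bexI[of _ "lam(l := \<alpha>)"] allI impI)
    show "lam(l := \<alpha>) \<in> Rvec (Suc l)" using lam(1) by (auto simp: mem_Rvec)
    fix \<rho> z assume z: "(\<rho>, z) \<in> G" "z \<in> Rvec (Suc l)"
    \<comment> \<open>Split \<open>z\<close> into a vector without coordinate \<open>l\<close> and
      \<open>z l *\<^sub>R e\<close>; the latter contributes \<open>\<alpha> * z l\<close>.\<close>
    have "dotp l lam (z - z l *\<^sub>R e) \<le> \<rho> - \<alpha> * z l"
    proof (rule lam(2))
      show "(\<rho> - \<alpha> * z l, z - z l *\<^sub>R e) \<in> G'"
        using z(1) by (auto simp: G'_def intro!: exI[of _ "z l"])
      show "z - z l *\<^sub>R e \<in> Rvec l"
        using z(2) by (auto simp: mem_Rvec e_def)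
    qed
    moreover have "dotp l lam (z - z l *\<^sub>R e) = dotp l lam z"
      by (simp add: dotp_def e_def)
    ultimately show "dotp (Suc l) (lam(l := \<alpha>)) z \<le> \<rho>"
      by (simp add: dotp_def)
  qed
qed

section \<open>Conic duality under essential strict feasibility\<close>

text \<open>The multiplier certifies the bound: for feasible \<open>v\<close>,
  \<open>c v = dotp m lam (a - B v) - dotp m lam a\<close>, which is at least
  \<open>\<beta>\<close>. Its \<open>L\<close>-part \<open>nu\<close> is found first; the orthant
  rows are then handled by Farkas, with no need for strictness there.\<close>

lemma conic_strong_duality:
  fixes B :: "'v::real_vector \<Rightarrow> rvec"
  assumes B: "linear B" and c: "linear c" and K: "convex_cone K" "K \<subseteq> Rvec m"
    and Rm: "\<And>v. B v \<in> Rvec m" "a \<in> Rvec m"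
    and feas: "ess_strictly_feasible m K UNIV B a"
    and bound: "\<And>v. cone_le K (B v) a \<Longrightarrow> \<beta> \<le> c v"
  shows "\<exists>lam\<in>dual_cone m K. (\<forall>v. dotp m lam (B v) = - c v) \<and> dotp m lam a \<le> - \<beta>"
proof -
  obtain j l L v0 y0 z0 where m: "m = j + l" and L: "regular_cone l L"
    and KL: "K = cone_prod j (orthant j) L" and y0: "y0 \<in> orthant j"
    and z0: "z0 \<in> Euclidean_space l interior_of L" and v0: "a - B v0 = vcat j y0 z0"
    using feas unfolding ess_strictly_feasible_def by blast
  have Lc: "convex_cone L" using L by (simp add: regular_cone_def)
  have mem_K: "w \<in> K \<longleftrightarrow> (\<forall>i<j. 0 \<le> w i) \<and> (\<lambda>i. w (j + i)) \<in> L" for w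
    by (simp add: KL mem_cone_prod_orthant)
  have v0K: "a - B v0 \<in> K"
    using subsetD[OF interior_of_subset z0] y0 unfolding v0 KL cone_prod_def by blast
  \<comment> \<open>Homogenization: \<open>w = (v, \<tau>)\<close> has slack \<open>\<tau> a - B v\<close>.\<close>
  define S where "S w = snd w *\<^sub>R a - B (fst w)" for w :: "'v \<times> real"
  define T where "T w = (\<lambda>i. S w (j + i))" for w
  define val where "val w = c (fst w) - \<beta> * snd w" for w :: "'v \<times> real"
  have S: "S (v + w) = S v + S w" "S (t *\<^sub>R w) = t *\<^sub>R S w" for v w t
    by (simp_all add: S_def linear_add[OF B] linear_scale[OF B] algebra_simps)
  have T: "T (v + w) = T v + T w" "T (t *\<^sub>R w) = t *\<^sub>R T w" for v w t
    by (auto simp: T_def S)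
  have val: "val (v + w) = val v + val w" "val (t *\<^sub>R w) = t * val w" for v w t
    by (simp_all add: val_def linear_add[OF c] linear_scale[OF c] algebra_simps)
  \<comment> \<open>For \<open>snd w = 0\<close>, \<open>fst w\<close> is a recession direction of
    the feasible set, and \<open>c\<close> cannot decrease along it. For \<open>snd w > 0\<close>,
    division by \<open>snd w\<close> gives a feasible point of the original constraint.\<close>
  have val_nonneg: "0 \<le> val w" if w: "0 \<le> snd w" "S w \<in> K" for w
  proof (cases "snd w = 0")
    case True
    then have BK: "- B (fst w) \<in> K" using w by (simp add: S_def)
    have *: "\<beta> \<le> c v0 + t * c (fst w)" if "0 \<le> t" for t
    proof -
      have "a - B v0 + t *\<^sub>R (- B (fst w)) \<in> K"
        by (intro convex_cone_add convex_cone_scaleR K v0K BK that)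
      then have "cone_le K (B (v0 + t *\<^sub>R fst w)) a"
        by (simp add: cone_le_def linear_add[OF B] linear_scale[OF B] algebra_simps)
      from bound[OF this] show ?thesis
        by (simp add: linear_add[OF c] linear_scale[OF c])
    qed
    have "0 \<le> c (fst w)"
    proof (rule ccontr)
      assume neg: "\<not> 0 \<le> c (fst w)"
      have "\<beta> \<le> c v0" using *[of 0] by simp
      \<comment> \<open>At this step length \<open>c v0 + t * c (fst w)\<close> equals
        \<open>\<beta> - 1\<close>, below the bound.\<close>
      with neg have "0 \<le> (c v0 - \<beta> + 1) / (- c (fst w))" by (intro divide_nonneg_nonneg) auto
      from *[OF this] neg show False by (simp add: field_simps)
    qed
    then show ?thesis using True by (simp add: val_def)
  next
    case False
    then have pos: "0 < snd w" using w by simp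
    have "(1 / snd w) *\<^sub>R S w \<in> K"
      using convex_cone_scaleR[OF K(1)] w by simp
    also have "(1 / snd w) *\<^sub>R S w = a - B ((1 / snd w) *\<^sub>R fst w)"
      using pos by (simp add: S_def linear_scale[OF B] scaleR_diff_right)
    finally have "\<beta> \<le> c ((1 / snd w) *\<^sub>R fst w)"
      by (intro bound) (unfold cone_le_def)
    then show ?thesis
      using pos by (simp add: val_def linear_scale[OF c] field_simps)
  qed
  \<comment> \<open>Only the \<open>L\<close>-rows are perturbed; the polyhedral rows, which need not hold strictly, stay as
    constraints on \<open>w\<close>.\<close>
  define G where "G = {(\<rho>, z). \<exists>w. 0 \<le> snd w \<and> (\<forall>i<j. 0 \<le> S w i) \<and> T w - z \<in> L \<and> val w \<le> \<rho>}"
  have GI: "(\<rho>, z) \<in> G"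
    if "0 \<le> snd w" "\<And>i. i < j \<Longrightarrow> 0 \<le> S w i" "T w - z \<in> L" "val w \<le> \<rho>" for \<rho> z w
    using that unfolding G_def by blast
  have "\<exists>lam\<in>Rvec l. \<forall>\<rho> z. (\<rho>, z) \<in> G \<longrightarrow> z \<in> Rvec l \<longrightarrow> dotp l lam z \<le> \<rho>"
  proof (rule cone_supporting_functional)
    fix g h assume "g \<in> G" "h \<in> G"
    then obtain v w where
      v: "0 \<le> snd v" "\<forall>i<j. 0 \<le> S v i" "T v - snd g \<in> L" "val v \<le> fst g" and
      w: "0 \<le> snd w" "\<forall>i<j. 0 \<le> S w i" "T w - snd h \<in> L" "val w \<le> fst h"
      by (auto simp: G_def)
    have "T (v + w) - (snd g + snd h) \<in> L"
      using convex_cone_add[OF Lc v(3) w(3)] by (simp add: T algebra_simps)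
    then have "(fst g + fst h, snd g + snd h) \<in> G"
      using v w by (intro GI[of "v + w"]) (simp_all add: S val)
    then show "g + h \<in> G" by (simp add: plus_prod_def)
  next
    fix g t assume "g \<in> G" "0 < (t::real)"
    then obtain v where
      v: "0 \<le> snd v" "\<forall>i<j. 0 \<le> S v i" "T v - snd g \<in> L" "val v \<le> fst g"
      by (auto simp: G_def)
    have "T (t *\<^sub>R v) - t *\<^sub>R snd g \<in> L"
      using convex_cone_scaleR[OF Lc _ v(3), of t] \<open>0 < t\<close> by (simp add: T algebra_simps)
    then have "(t * fst g, t *\<^sub>R snd g) \<in> G"
      using v \<open>0 < t\<close> by (intro GI[of "t *\<^sub>R v"]) (simp_all add: S val)
    then show "t *\<^sub>R g \<in> G" by (simp add: scaleR_prod_def)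
  next
    fix z assume "z \<in> Rvec l"
    \<comment> \<open>Here the interiority of \<open>z0\<close> enters: a large multiple of the
      homogenized Slater point \<open>(v0, 1)\<close> absorbs any perturbation \<open>z\<close>, so
      \<open>G\<close> has a point over each \<open>z\<close>.\<close>
    from interior_of_cone_absorbing[OF Lc z0 this]
    obtain \<tau> where \<tau>: "\<tau> > 0" "\<tau> *\<^sub>R z0 - z \<in> L" by blast
    have S0: "S (\<tau> *\<^sub>R (v0, 1)) = \<tau> *\<^sub>R vcat j y0 z0"
      unfolding S by (simp add: S_def v0)
    then have "T (\<tau> *\<^sub>R (v0, 1)) = \<tau> *\<^sub>R z0"
      unfolding T_def by (auto simp: vcat_def)
    moreover have "\<forall>i<j. 0 \<le> S (\<tau> *\<^sub>R (v0, 1)) i"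
      unfolding S0 using y0 \<tau> by (auto simp: vcat_def orthant_def)
    ultimately have "(val (\<tau> *\<^sub>R (v0, 1)), z) \<in> G"
      using \<tau> by (intro GI[of "\<tau> *\<^sub>R (v0, 1)"]) simp_all
    then show "\<exists>\<rho>. (\<rho>, z) \<in> G" ..
  next
    fix \<rho> assume "(\<rho>, 0) \<in> G"
    then obtain w where "0 \<le> snd w" "\<forall>i<j. 0 \<le> S w i" "T w \<in> L" "val w \<le> \<rho>"
      by (auto simp: G_def)
    then show "0 \<le> \<rho>"
      using val_nonneg[of w] by (auto simp: mem_K T_def)
  qed
  then obtain nu where nu: "nu \<in> Rvec l"
    "\<And>\<rho> z. (\<rho>, z) \<in> G \<Longrightarrow> z \<in> Rvec l \<Longrightarrow> dotp l nu z \<le> \<rho>" by blast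
  have L0: "0 \<in> L" using Lc by (simp add: convex_cone_contains_0)
  have TR: "T w \<in> Rvec l" for w
    using Rm by (simp add: T_def S_def mem_Rvec m)
  have dual_L: "0 \<le> dotp l nu z" if "z \<in> L" for z
  proof -
    have z: "z \<in> Rvec l" using that regular_cone_subset_Rvec[OF L] by blast
    have "S 0 = 0" by (simp add: S_def linear_0[OF B])
    \<comment> \<open>With \<open>w = 0\<close>, each \<open>z\<close> in \<open>L\<close> gives a
      point \<open>(0, -z)\<close> of \<open>G\<close>, so \<open>nu\<close> is nonpositive at
      \<open>-z\<close>.\<close>
    moreover from this have "T 0 = 0" by (simp add: T_def fun_eq_iff)
    ultimately have "(0, (-1) *\<^sub>R z) \<in> G"
      using that by (intro GI[of 0]) (simp_all add: val_def linear_0[OF c])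
    from nu(2)[OF this] show ?thesis using z unfolding dotp_scaleR_right by (simp add: mem_Rvec)
  qed
  \<comment> \<open>The inequality with index \<open>j\<close> is nonnegativity of the homogenizing
    variable, hence \<open>Suc j\<close> functionals in the Farkas lemma.\<close>
  define \<phi> where "\<phi> i w = (if i < j then S w i else snd w)" for i w
  have "\<exists>\<mu>. (\<forall>i<Suc j. 0 \<le> \<mu> i) \<and> (\<forall>w. val w - dotp l nu (T w) = (\<Sum>i<Suc j. \<mu> i * \<phi> i w))"
  proof (rule linear_farkas)
    show "linear (\<phi> i)" for i
      by (rule linearI) (auto simp: \<phi>_def S)
    show "linear (\<lambda>w. val w - dotp l nu (T w))"
      by (rule linearI) (simp_all add: T val dotp_add_right dotp_scaleR_right algebra_simps)
    fix w assume *: "\<And>i. i < Suc j \<Longrightarrow> 0 \<le> \<phi> i w"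
    have "0 \<le> snd w" using *[of j] by (simp add: \<phi>_def)
    moreover have "\<forall>i<j. 0 \<le> S w i" using * by (metis \<phi>_def less_SucI)
    \<comment> \<open>With \<open>z = T w\<close> the \<open>L\<close>-rows have slack
      \<open>0\<close>, so only the inequalities \<open>\<phi>\<close> are required of
      \<open>w\<close>.\<close>
    ultimately have "(val w, T w) \<in> G" using L0 by (intro GI[of w]) simp_all
    from nu(2)[OF this TR] show "0 \<le> val w - dotp l nu (T w)" by simp
  qed
  then obtain \<mu> where \<mu>: "\<And>i. i < Suc j \<Longrightarrow> 0 \<le> \<mu> i"
    "\<And>w. val w - dotp l nu (T w) = (\<Sum>i<Suc j. \<mu> i * \<phi> i w)" by blast
  define lam where "lam = vcat j \<mu> nu"
  have dotp_lam: "dotp m lam w = (\<Sum>i<j. \<mu> i * w i) + dotp l nu (\<lambda>i. w (j + i))" for w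
    by (simp add: m dotp_append lam_def vcat_def) (simp add: dotp_def)
  \<comment> \<open>At \<open>(v, 0)\<close> this gives dual feasibility. At \<open>(0, 1)\<close>
    it gives the bound, since \<open>\<mu> j\<close> is nonnegative.\<close>
  have key: "val w = dotp m lam (S w) + \<mu> j * snd w" for w
    using \<mu>(2)[of w] by (simp add: dotp_lam \<phi>_def T_def)
  show ?thesis
  proof (intro bexI[of _ lam] conjI allI)
    show "dotp m lam (B v) = - c v" for v
      using key[of "(v, 0)"] dotp_scaleR_right[of m lam "-1" "B v"] by (simp add: val_def S_def)
    show "dotp m lam a \<le> - \<beta>"
      using key[of "(0, 1)"] \<mu>(1)[of j] by (simp add: val_def S_def linear_0[OF B] linear_0[OF c])
    show "lam \<in> dual_cone m K"
    proof -
      have "lam \<in> Rvec m" using nu(1) by (auto simp: lam_def vcat_def mem_Rvec m)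
      moreover have "0 \<le> dotp m lam x" if "x \<in> K" for x
        using that \<mu>(1) dual_L unfolding dotp_lam mem_K by (auto intro!: add_nonneg_nonneg sum_nonneg)
      ultimately show ?thesis by (simp add: dual_cone_def)
    qed
  qed
qed

section \<open>Finite systems as single conic constraints\<close>

lemma mat_mult_rows: "mat_mult m k U u = (\<lambda>i. if i < m then dotp k (U i) u else 0)"
  by (auto simp: mat_mult_def dotp_def fun_eq_iff)

lemma conic_constraint_setI:
  assumes "K \<in> KK m" "T \<in> Rvec m" "a \<in> Rvec m"
    and "\<And>t g x u. (t, g, x, u) \<in> S \<longleftrightarrow> u \<in> Rvec k \<and>
           cone_le K (rows_mult m M x + rows_mult m G g + t *\<^sub>R T + mat_mult m k U u) a"
  shows "conic_constraint_set KK k S"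
proof -
  have "S = {(t, g, x, u). u \<in> Rvec k \<and>
           cone_le K (rows_mult m M x + rows_mult m G g + t *\<^sub>R T + mat_mult m k U u) a}"
    using assms(4) by auto
  then show ?thesis
    unfolding conic_constraint_set_def using assms(1-3) by blast
qed

lemma dotp_vcat: "dotp (m + l) (vcat m x y) (vcat m x' y') = dotp m x x' + dotp l y y'"
  unfolding dotp_append by (simp add: dotp_def vcat_def)

text \<open>Stack the rows and the right-hand sides; the slack of the stacked system lies in the
  product cone, which belongs to the family, exactly when both slacks lie in their cones.\<close>

lemma conic_constraint_set_Int:
  assumes KK: "cone_family KK"
    and "conic_constraint_set KK k S" "conic_constraint_set KK k S'"
  shows "conic_constraint_set KK k (S \<inter> S')"
proof -
  obtain m K M G T U a where 1: "K \<in> KK m" "T \<in> Rvec m" "a \<in> Rvec m"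
    and S: "S = {(t, g, x, u). u \<in> Rvec k \<and>
        cone_le K (rows_mult m M x + rows_mult m G g + t *\<^sub>R T + mat_mult m k U u) a}"
    using assms(2) unfolding conic_constraint_set_def by blast
  obtain m' K' M' G' T' U' a' where 2: "K' \<in> KK m'" "T' \<in> Rvec m'" "a' \<in> Rvec m'"
    and S': "S' = {(t, g, x, u). u \<in> Rvec k \<and>
        cone_le K' (rows_mult m' M' x + rows_mult m' G' g + t *\<^sub>R T' + mat_mult m' k U' u) a'}"
    using assms(3) unfolding conic_constraint_set_def by blast
  define glue :: "(nat \<Rightarrow> 'a) \<Rightarrow> (nat \<Rightarrow> 'a) \<Rightarrow> nat \<Rightarrow> 'a"
    where "glue P P' = (\<lambda>i. if i < m then P i else P' (i - m))" for P P'
  define V where "V = (\<lambda>i. if i < m then U i else U' (i - m))"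
  have K: "K \<subseteq> Rvec m"
    using KK 1(1) regular_cone_subset_Rvec unfolding cone_family_def by blast
  have split: "cone_le (cone_prod m K K')
       (rows_mult (m + m') (glue M M') x + rows_mult (m + m') (glue G G') g + t *\<^sub>R vcat m T T'
          + mat_mult (m + m') k V u) (vcat m a a')
     \<longleftrightarrow> cone_le K (rows_mult m M x + rows_mult m G g + t *\<^sub>R T + mat_mult m k U u) a
       \<and> cone_le K' (rows_mult m' M' x + rows_mult m' G' g + t *\<^sub>R T' + mat_mult m' k U' u) a'"
    (is "cone_le _ ?b _ \<longleftrightarrow> cone_le K ?b1 a \<and> cone_le K' ?b2 a'") for x g t u
  proof -
    have "(\<lambda>i. if i < m then (vcat m a a' - ?b) i else 0) = a - ?b1"
      using 1 by (auto simp: fun_eq_iff vcat_def rows_mult_def mat_mult_rows glue_def V_def mem_Rvec)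
    moreover have "(\<lambda>i. (vcat m a a' - ?b) (m + i)) = a' - ?b2"
      by (auto simp: fun_eq_iff vcat_def rows_mult_def mat_mult_rows glue_def V_def)
    ultimately show ?thesis
      unfolding cone_le_def mem_cone_prod[OF K] by simp
  qed
  have "cone_prod m K K' \<in> KK (m + m')"
    using KK 1 2 unfolding cone_family_def by blast
  moreover have "vcat m T T' \<in> Rvec (m + m')" "vcat m a a' \<in> Rvec (m + m')"
    using 1 2 by (auto simp: vcat_def mem_Rvec)
  moreover have "S \<inter> S' = {(t, g, x, u). u \<in> Rvec k \<and> cone_le (cone_prod m K K')
       (rows_mult (m + m') (glue M M') x + rows_mult (m + m') (glue G G') g + t *\<^sub>R vcat m T T'
          + mat_mult (m + m') k V u) (vcat m a a')}"
    unfolding split S S' by blast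
  ultimately show ?thesis
    unfolding conic_constraint_set_def by blast
qed

text \<open>The extra set \<open>S0\<close> covers an empty \<open>I\<close>: the bare intersection
  would then be everything, without the restriction of \<open>u\<close> to
  \<open>Rvec k\<close>.\<close>

lemma conic_constraint_set_INT:
  assumes "cone_family KK" "conic_constraint_set KK k S0" "finite I"
    and "\<And>i. i \<in> I \<Longrightarrow> conic_constraint_set KK k (S i)"
  shows "conic_constraint_set KK k (S0 \<inter> (\<Inter>i\<in>I. S i))"
  using assms(3,4)
proof (induction I rule: finite_induct)
  case empty
  then show ?case using assms(2) by simp
next
  case (insert i I)
  have "S0 \<inter> (\<Inter>i\<in>insert i I. S i) = S i \<inter> (S0 \<inter> (\<Inter>i\<in>I. S i))" by blast
  then show ?case
    using conic_constraint_set_Int[OF assms(1) insert.prems insert.IH] insert.prems by simp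
qed

text \<open>The half-line \<open>orthant 1\<close> is in the family, and one row with this cone is a
  scalar inequality. The variable \<open>x\<close> is left out because the target system involves it
  only in its primal conic constraint.\<close>

lemma conic_constraint_set_halfspace:
  fixes \<beta> :: "'a::euclidean_space"
  assumes "cone_family KK"
  shows "conic_constraint_set KK k {(t, g, x, u). u \<in> Rvec k \<and> \<beta> \<bullet> g + \<gamma> * t + dotp k \<delta> u \<le> c}"
proof -
  have 1: "orthant 1 \<in> KK 1" using assms by (simp add: cone_family_def)
  have 2: "vsingle r \<in> Rvec 1" for r by (simp add: vsingle_def mem_Rvec)
  have "cone_le (orthant 1) (rows_mult 1 (\<lambda>_. 0) x + rows_mult 1 (\<lambda>_. \<beta>) g
         + t *\<^sub>R vsingle \<gamma> + mat_mult 1 k (\<lambda>_. \<delta>) u) (vsingle c)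
       \<longleftrightarrow> \<beta> \<bullet> g + \<gamma> * t + dotp k \<delta> u \<le> c" for x g :: 'a and t u
    by (auto simp: cone_le_def orthant_def mem_Rvec rows_mult_def vsingle_def mat_mult_rows algebra_simps)
  then show ?thesis
    by (intro conic_constraint_setI[where m = 1 and K = "orthant 1" and M = "\<lambda>_. 0" and G = "\<lambda>_. \<beta>"
          and T = "vsingle \<gamma>" and U = "\<lambda>_. \<delta>" and a = "vsingle c"] 1 2) (simp del: One_nat_def)
qed

lemma conic_constraint_set_hyperplane:
  assumes "cone_family KK"
  shows "conic_constraint_set KK k {(t, g, x, u). u \<in> Rvec k \<and> \<beta> \<bullet> g + dotp k \<delta> u = c}"
proof -
  have eq: "{(t, g, x, u). u \<in> Rvec k \<and> \<beta> \<bullet> g + dotp k \<delta> u = c} =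
      {(t, g, x, u). u \<in> Rvec k \<and> \<beta> \<bullet> g + 0 * t + dotp k \<delta> u \<le> c} \<inter>
      {(t, g, x, u). u \<in> Rvec k \<and> (- \<beta>) \<bullet> g + 0 * t + dotp k (- \<delta>) u \<le> - c}"
    by (auto simp: dotp_def sum_negf)
  show ?thesis
    unfolding eq by (intro conic_constraint_set_Int conic_constraint_set_halfspace assms)
qed

lemma conic_constraint_set_cone:
  assumes "K \<in> KK m" "a \<in> Rvec m"
  shows "conic_constraint_set KK k
     {(t, g, x, u). u \<in> Rvec k \<and> cone_le K (rows_mult m A x + mat_mult m k U u) a}"
proof -
  have z: "rows_mult m (\<lambda>_. 0) g = 0" for g :: 'a
    by (auto simp: rows_mult_def)
  show ?thesis
    by (rule conic_constraint_setI[where m = m and K = K and T = 0 and G = "\<lambda>_. 0" and M = A and U = U and a = a])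
      (simp_all add: z mem_Rvec assms[unfolded mem_Rvec])
qed

text \<open>The system is a finite intersection of half-spaces, hyperplanes and two conic
  constraints; the one on \<open>lam\<close> is admissible because the family is closed under
  duality.\<close>

lemma conic_constraint_set_primal_dual:
  fixes A :: "nat \<Rightarrow> 'a::euclidean_space"
  assumes KK: "cone_family KK" and K: "K \<in> KK m" and a: "a \<in> Rvec m" and p: "p \<in> Rvec m"
  shows "conic_constraint_set KK (1 + (1 + (m + k)))
     {(t, g, x, vcat 1 (vsingle s) (vcat 1 (vsingle r) (vcat m lam u))) | t g x s r lam u.
        lam \<in> Rvec m \<and> u \<in> Rvec k \<and>
        t \<ge> s + r \<and>
        cone_le K (rows_mult m A x + s *\<^sub>R p + mat_mult m k Q u) a \<and>
        r \<ge> dotp m a lam \<and>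
        rows_tmult m A lam = g \<and>
        dotp m p lam = -1 \<and>
        mat_tmult m k Q lam = 0 \<and>
        cone_le (dual_cone m K) 0 lam}"
    (is "conic_constraint_set KK ?N ?S")
proof -
  \<comment> \<open>\<open>W\<close> packs the additional variables into one vector. Packing
    coefficients in the same way turns each linear form in \<open>s\<close>, \<open>r\<close>,
    \<open>lam\<close>, \<open>u\<close> into a \<open>dotp\<close> with a \<open>W\<close>
    vector.\<close>
  define W where "W s r v u = vcat 1 (vsingle s) (vcat 1 (vsingle r) (vcat m v u))" for s r v u
  have W_in: "W s r v u \<in> Rvec ?N" if "u \<in> Rvec k" for s r v u
    using that by (auto simp: W_def vcat_def vsingle_def mem_Rvec)
  have W_ex: "\<exists>s r v u. v \<in> Rvec m \<and> u \<in> Rvec k \<and> w = W s r v u" if "w \<in> Rvec ?N" for w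
  proof -
    define v where "v = (\<lambda>i. if i < m then w (i + 2) else 0)"
    define u where "u = (\<lambda>i. w (i + m + 2))"
    have "w i = W (w 0) (w 1) v u i" for i
      by (cases i; cases "i - 1") (auto simp: W_def vcat_def vsingle_def v_def u_def)
    moreover have "v \<in> Rvec m" "u \<in> Rvec k"
      using that by (auto simp: mem_Rvec v_def u_def)
    ultimately show ?thesis by (metis ext)
  qed
  have dotp_W: "dotp ?N (W d e v q) (W s r lam u) = d * s + e * r + dotp m v lam + dotp k q u"
    for d e v q s r lam u
    unfolding W_def dotp_vcat by (simp add: dotp_def vsingle_def)
  have dotp0: "dotp n (\<lambda>_. 0) v = 0" "dotp n 0 v = 0" for n v by (simp_all add: dotp_def)
  \<comment> \<open>In turn: \<open>t \<ge> s + r\<close>; the bound on \<open>r\<close>; the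
    component along \<open>b\<close> of \<open>A^T lam = g\<close>; \<open>p^T lam = -1\<close>;
    entry \<open>i\<close> of \<open>Q^T lam = 0\<close>; the primal constraint; dual cone
    membership.\<close>
  define C1 where "C1 = {(t, g, x::'a, w). w \<in> Rvec ?N \<and> (0::'a) \<bullet> g + (-1) * t + dotp ?N (W 1 1 0 0) w \<le> 0}"
  define C2 where "C2 = {(t, g, x::'a, w). w \<in> Rvec ?N \<and> (0::'a) \<bullet> g + 0 * t + dotp ?N (W 0 (-1) a 0) w \<le> 0}"
  define C3 where "C3 b = {(t::real, g, x::'a, w). w \<in> Rvec ?N \<and> (- b :: 'a) \<bullet> g + dotp ?N (W 0 0 (\<lambda>i. A i \<bullet> b) 0) w = 0}" for b
  define C4 where "C4 = {(t::real, g, x::'a, w). w \<in> Rvec ?N \<and> (0::'a) \<bullet> g + dotp ?N (W 0 0 p 0) w = -1}"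
  define C5 where "C5 i = {(t::real, g, x::'a, w). w \<in> Rvec ?N \<and> (0::'a) \<bullet> g + dotp ?N (W 0 0 (\<lambda>j. Q j i) 0) w = 0}" for i
  define C6 where "C6 = {(t::real, g::'a, x, w). w \<in> Rvec ?N \<and> cone_le K
     (rows_mult m A x + mat_mult m ?N (\<lambda>i. W (p i) 0 0 (Q i)) w) a}"
  \<comment> \<open>Row \<open>i\<close> is minus a unit vector, so the left-hand side is
    \<open>- lam\<close> and the slack against \<open>0\<close> is \<open>lam\<close>.\<close>
  define C7 where "C7 = {(t::real, g::'a, x::'a, w). w \<in> Rvec ?N \<and> cone_le (dual_cone m K)
     (rows_mult m (\<lambda>_. 0) x + mat_mult m ?N (\<lambda>i. W 0 0 (\<lambda>j. if j = i then -1 else 0) 0) w) 0}"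
  define C where "C = C1 \<inter> (C2 \<inter> (C4 \<inter> (C6 \<inter> C7))) \<inter> (\<Inter>b\<in>Basis. C3 b) \<inter> (\<Inter>i\<in>{..<k}. C5 i)"
  have C: "conic_constraint_set KK ?N C"
    unfolding C_def
  proof (intro conic_constraint_set_INT conic_constraint_set_Int KK finite_Basis finite_lessThan)
    show "conic_constraint_set KK ?N C6"
      unfolding C6_def by (rule conic_constraint_set_cone[where KK = KK, OF K a])
    have "dual_cone m K \<in> KK m" using KK K unfolding cone_family_def by blast
    then show "conic_constraint_set KK ?N C7"
      unfolding C7_def by (rule conic_constraint_set_cone[where KK = KK]) (simp add: mem_Rvec)
  qed (unfold C1_def C2_def C3_def C4_def C5_def,
      (rule conic_constraint_set_halfspace[OF KK] conic_constraint_set_hyperplane[OF KK])+)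
  have mem: "(t, g, x, W s r lam u) \<in> C \<longleftrightarrow>
        t \<ge> s + r \<and>
        cone_le K (rows_mult m A x + s *\<^sub>R p + mat_mult m k Q u) a \<and>
        r \<ge> dotp m a lam \<and>
        rows_tmult m A lam = g \<and>
        dotp m p lam = -1 \<and>
        mat_tmult m k Q lam = 0 \<and>
        cone_le (dual_cone m K) 0 lam"
    if lam: "lam \<in> Rvec m" and u: "u \<in> Rvec k" for t g x s r lam u
  proof -
    have 1: "(t, g, x, W s r lam u) \<in> C1 \<longleftrightarrow> t \<ge> s + r"
      by (simp add: C1_def W_in[OF u] dotp_W dotp0 del: One_nat_def)
    have 2: "(t, g, x, W s r lam u) \<in> C2 \<longleftrightarrow> r \<ge> dotp m a lam"
      by (simp add: C2_def W_in[OF u] dotp_W dotp0 del: One_nat_def)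
    have "dotp m (\<lambda>i. A i \<bullet> b) lam = rows_tmult m A lam \<bullet> b" for b
      by (simp add: dotp_def rows_tmult_def inner_sum_left mult.commute)
    then have "(t, g, x, W s r lam u) \<in> C3 b \<longleftrightarrow> rows_tmult m A lam \<bullet> b = g \<bullet> b" for b
      by (simp add: C3_def W_in[OF u] dotp_W dotp0 inner_commute del: One_nat_def)
    then have 3: "(t, g, x, W s r lam u) \<in> (\<Inter>b\<in>Basis. C3 b) \<longleftrightarrow> rows_tmult m A lam = g"
      by (simp add: euclidean_eq_iff[of "rows_tmult m A lam"])
    have 4: "(t, g, x, W s r lam u) \<in> C4 \<longleftrightarrow> dotp m p lam = -1"
      by (simp add: C4_def W_in[OF u] dotp_W dotp0 del: One_nat_def)
    have "(t, g, x, W s r lam u) \<in> C5 i \<longleftrightarrow> dotp m (\<lambda>j. Q j i) lam = 0" for i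
      by (simp add: C5_def W_in[OF u] dotp_W dotp0 del: One_nat_def)
    then have 5: "(t, g, x, W s r lam u) \<in> (\<Inter>i\<in>{..<k}. C5 i) \<longleftrightarrow> mat_tmult m k Q lam = 0"
      by (auto simp: mat_tmult_def mat_mult_rows fun_eq_iff)
    have "mat_mult m ?N (\<lambda>i. W (p i) 0 0 (Q i)) (W s r lam u) = s *\<^sub>R p + mat_mult m k Q u"
      using p unfolding mat_mult_rows dotp_W by (auto simp: dotp0 mem_Rvec fun_eq_iff)
    then have 6: "(t, g, x, W s r lam u) \<in> C6 \<longleftrightarrow>
        cone_le K (rows_mult m A x + s *\<^sub>R p + mat_mult m k Q u) a"
      using W_in[OF u] unfolding C6_def by (simp add: add.assoc del: One_nat_def)
    have "dotp m (\<lambda>j. if j = i then -1 else 0) lam = - lam i" if "i < m" for i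
      using that unfolding dotp_def by (subst sum.cong[OF refl, of _ _ "\<lambda>j. if j = i then - lam i else 0"]) auto
    then have e7: "rows_mult m (\<lambda>_. 0) x + mat_mult m ?N (\<lambda>i. W 0 0 (\<lambda>j. if j = i then -1 else 0) 0) (W s r lam u) = - lam"
      using lam unfolding mat_mult_rows dotp_W by (auto simp: dotp0 mem_Rvec fun_eq_iff rows_mult_def)
    then have 7: "(t, g, x, W s r lam u) \<in> C7 \<longleftrightarrow> cone_le (dual_cone m K) 0 lam"
      unfolding C7_def by (simp only: mem_Collect_eq case_prod_conv e7 W_in[OF u] cone_le_def) simp
    show ?thesis
      unfolding C_def Int_iff 1 2 3 4 5 6 7 by blast
  qed
  define R where "R t g x s r lam u \<longleftrightarrow>
        t \<ge> s + r \<and>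
        cone_le K (rows_mult m A x + s *\<^sub>R p + mat_mult m k Q u) a \<and>
        r \<ge> dotp m a lam \<and>
        rows_tmult m A lam = g \<and>
        dotp m p lam = -1 \<and>
        mat_tmult m k Q lam = 0 \<and>
        cone_le (dual_cone m K) 0 lam" for t g x s r lam u
  have "C = {(t, g, x, W s r lam u) | t g x s r lam u. lam \<in> Rvec m \<and> u \<in> Rvec k \<and> R t g x s r lam u}"
    (is "C = ?S'")
  proof (intro equalityI subsetI)
    fix z assume z: "z \<in> C"
    obtain t g x w where tgxw: "z = (t, g, x, w)" by (cases z)
    with z have "w \<in> Rvec ?N" unfolding C_def C1_def by blast
    from W_ex[OF this] z mem show "z \<in> ?S'"
      unfolding tgxw R_def[symmetric] by blast
  qed (use mem[folded R_def] in blast)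
  then have "?S = C"
    unfolding R_def W_def by simp
  with C show ?thesis by simp
qed

section \<open>Gradient inequality for derivatives within a convex set\<close>

text \<open>Restrict \<open>f\<close> to the segment from \<open>x\<close> to \<open>y\<close>,
  which stays in \<open>X\<close>. By convexity each difference quotient at \<open>x\<close> is at
  most \<open>f y - f x\<close>, and their limit is \<open>D (y - x)\<close>. Thus \<open>x\<close>
  may be a boundary point.\<close>

lemma convex_on_above_tangent_within:
  fixes f :: "'a::real_normed_vector \<Rightarrow> real"
  assumes f: "convex_on X f" and D: "(f has_derivative D) (at x within X)" and xy: "x \<in> X" "y \<in> X"
  shows "f x + D (y - x) \<le> f y"
proof -
  define \<gamma> where "\<gamma> t = x + t *\<^sub>R (y - x)" for t :: real
  have X: "convex X" using f by (simp add: convex_on_def)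
  have \<gamma>: "\<gamma> t = (1 - t) *\<^sub>R x + t *\<^sub>R y" for t
    by (simp add: \<gamma>_def algebra_simps)
  have "\<gamma> ` {0..1} \<subseteq> X"
    using X xy unfolding \<gamma> by (auto intro: convexD_alt)
  then have "(f has_derivative D) (at (\<gamma> 0) within \<gamma> ` {0..1})"
    using D by (auto simp: \<gamma>_def intro: has_derivative_subset)
  moreover have "(\<gamma> has_derivative (\<lambda>t. t *\<^sub>R (y - x))) (at 0 within {0..1})"
    unfolding \<gamma>_def by (auto intro!: derivative_eq_intros)
  ultimately have "((f \<circ> \<gamma>) has_derivative (\<lambda>t. D (t *\<^sub>R (y - x)))) (at 0 within {0..1})"
    using diff_chain_within[of \<gamma> _ 0 "{0..1}" f D] by (simp add: o_def)
  moreover have "(\<lambda>t. D (t *\<^sub>R (y - x))) = (*) (D (y - x))"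
    by (simp add: fun_eq_iff linear_scale[OF has_derivative_linear[OF D]])
  ultimately have "((f \<circ> \<gamma>) has_real_derivative D (y - x)) (at 0 within {0..1})"
    by (simp add: has_field_derivative_def)
  then have lim: "((\<lambda>t. (f (\<gamma> t) - f x) / t) \<longlongrightarrow> D (y - x)) (at 0 within {0..1})"
    by (simp add: has_field_derivative_iff \<gamma>_def)
  have ev: "\<forall>\<^sub>F t in at 0 within {0..1}. (f (\<gamma> t) - f x) / t \<le> f y - f x"
    unfolding eventually_at_filter
  proof (intro always_eventually allI impI)
    fix t :: real assume "t \<noteq> 0" "t \<in> {0..1}"
    moreover from this have "f (\<gamma> t) \<le> (1 - t) * f x + t * f y"
      unfolding \<gamma> using xy by (intro convex_onD[OF f]) auto
    ultimately show "(f (\<gamma> t) - f x) / t \<le> f y - f x"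
      by (simp add: field_simps)
  qed
  have "at (0::real) within {0..1} \<noteq> bot"
    by (simp add: trivial_limit_within islimpt_Icc)
  from tendsto_upperbound[OF lim ev this] show ?thesis by simp
qed

section \<open>The primal-dual system represents the gradient field\<close>

theorem mainTheorem12:
  fixes KK :: "nat \<Rightarrow> rvec set set"
    and X :: "(real ^ 'n) set"
    and f :: "real ^ 'n \<Rightarrow> real"
    and F :: "real ^ 'n \<Rightarrow> real ^ 'n"
    and m k :: nat
    and K :: "rvec set"
    and A :: "nat \<Rightarrow> real ^ 'n"
    and Q :: "nat \<Rightarrow> nat \<Rightarrow> real"
    and p a :: rvec
  assumes "cone_family KK"
    and "X \<noteq> {}" "convex X" "compact X"
    and "convex_on X f"
    and "gradient_field X f F"
    and "K \<in> KK m"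
    and "p \<in> Rvec m" "a \<in> Rvec m"
    and "{(x, s). x \<in> X \<and> f x \<le> s} =
         {(x, s). \<exists>u\<in>Rvec k. cone_le K (rows_mult m A x + s *\<^sub>R p + mat_mult m k Q u) a}"
    and "ess_strictly_feasible m K (UNIV \<times> UNIV \<times> Rvec k)
           (\<lambda>(x, s, u). rows_mult m A x + s *\<^sub>R p + mat_mult m k Q u) a"
  shows "K_representation KK (1 + (1 + (m + k)))
           {(t, g, x, vcat 1 (vsingle s) (vcat 1 (vsingle r) (vcat m lam u))) | t g x s r lam u.
              lam \<in> Rvec m \<and> u \<in> Rvec k \<and>
              t \<ge> s + r \<and>
              cone_le K (rows_mult m A x + s *\<^sub>R p + mat_mult m k Q u) a \<and>
              r \<ge> dotp m a lam \<and>
              rows_tmult m A lam = g \<and>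
              dotp m p lam = -1 \<and>
              mat_tmult m k Q lam = 0 \<and>
              cone_le (dual_cone m K) 0 lam}
           F X"
proof -
  note KK = assms(1) and K = assms(7) and p = assms(8) and a = assms(9)
  define \<Phi> where "\<Phi> x s u = rows_mult m A x + s *\<^sub>R p + mat_mult m k Q u" for x s u
  have epi: "x \<in> X \<and> f x \<le> s \<longleftrightarrow> (\<exists>u\<in>Rvec k. cone_le K (\<Phi> x s u) a)" for x s
    using assms(10) unfolding \<Phi>_def set_eq_iff by auto
  have tangent: "f x + F x \<bullet> (y - x) \<le> f y" if "x \<in> X" "y \<in> X" for x y
    using assms(6) that by (intro convex_on_above_tangent_within[OF assms(5)]) (auto simp: gradient_field_def)
  have reg: "regular_cone m K" using KK K unfolding cone_family_def by blast
  define S where "S = {(t, g, x, vcat 1 (vsingle s) (vcat 1 (vsingle r) (vcat m lam u))) | t g x s r lam u.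
              lam \<in> Rvec m \<and> u \<in> Rvec k \<and>
              t \<ge> s + r \<and>
              cone_le K (\<Phi> x s u) a \<and>
              r \<ge> dotp m a lam \<and>
              rows_tmult m A lam = g \<and>
              dotp m p lam = -1 \<and>
              mat_tmult m k Q lam = 0 \<and>
              cone_le (dual_cone m K) 0 lam}"
  define TT where "TT = {(t, g, x). \<exists>w. (t, g, x, w) \<in> S}"
  have TT: "(t, g, x) \<in> TT \<longleftrightarrow> (\<exists>s r lam u. lam \<in> Rvec m \<and> u \<in> Rvec k \<and>
              t \<ge> s + r \<and>
              cone_le K (\<Phi> x s u) a \<and>
              r \<ge> dotp m a lam \<and>
              rows_tmult m A lam = g \<and>
              dotp m p lam = -1 \<and>
              mat_tmult m k Q lam = 0 \<and>
              lam \<in> dual_cone m K)" for t g x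
  proof -
    have "cone_le (dual_cone m K) 0 lam \<longleftrightarrow> lam \<in> dual_cone m K" for lam
      by (simp add: cone_le_def)
    then show ?thesis
      unfolding TT_def S_def by blast
  qed
  have pair: "dotp m lam (\<Phi> x s u) = rows_tmult m A lam \<bullet> x + s * dotp m p lam + dotp k (mat_tmult m k Q lam) u"
    for lam x s u
  proof -
    have "dotp m lam (rows_mult m A x) = rows_tmult m A lam \<bullet> x"
      by (simp add: dotp_def rows_mult_def rows_tmult_def inner_sum_left)
    moreover have "dotp m lam (mat_mult m k Q u) = dotp k (mat_tmult m k Q lam) u"
      by (simp add: dotp_def mat_mult_def mat_tmult_def sum_distrib_left sum_distrib_right algebra_simps)
        (rule sum.swap)
    ultimately show ?thesis
      by (simp add: \<Phi>_def dotp_add_right dotp_scaleR_right dotp_commute[of m lam p])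
  qed
  have "TT \<subseteq> FF F X"
  proof (clarify)
    fix t g x assume "(t, g, x) \<in> TT"
    then obtain s r lam u where *: "u \<in> Rvec k" "t \<ge> s + r" "cone_le K (\<Phi> x s u) a" "r \<ge> dotp m a lam"
      "rows_tmult m A lam = g" "dotp m p lam = -1" "mat_tmult m k Q lam = 0" "lam \<in> dual_cone m K"
      unfolding TT by blast
    then have x: "x \<in> X" "f x \<le> s" using epi by blast+
    \<comment> \<open>The chain is \<open>F y \<bullet> (x - y) \<le> f x - f y \<le> s + r - g
      \<bullet> y \<le> t - g \<bullet> y\<close>, where \<open>g \<bullet> y - f y \<le> r\<close>
      comes from pairing \<open>lam\<close> with the slack at \<open>(y, f y)\<close>.\<close>
    have "F y \<bullet> (x - y) \<le> t - g \<bullet> y" if y: "y \<in> X" for y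
    proof -
      obtain v where "cone_le K (\<Phi> y (f y) v) a" using y epi[of y "f y"] by blast
      then have "0 \<le> dotp m lam (a - \<Phi> y (f y) v)"
        using *(8) by (simp add: dual_cone_def cone_le_def)
      then have "0 \<le> dotp m lam a - (g \<bullet> y - f y)"
        unfolding dotp_diff_right pair by (simp add: *)
      then show ?thesis
        using tangent[OF y x(1)] x(2) *(2,4) by (simp add: dotp_commute[of m lam a])
    qed
    with x show "(t, g, x) \<in> FF F X" by (simp add: FF_def)
  qed
  moreover have "\<forall>t g x t'. (t, g, x) \<in> TT \<longrightarrow> t \<le> t' \<longrightarrow> (t', g, x) \<in> TT"
    unfolding TT by (blast intro: order_trans)
  moreover have "(F x \<bullet> x, F x, x) \<in> TT" if x: "x \<in> X" for x
  proof -
    define B where "B v = \<Phi> (fst v) (fst (snd v)) (snd (snd v))" for v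
    define c where "c v = fst (snd v) - F x \<bullet> fst v" for v :: "(real ^ 'n) \<times> real \<times> rvec"
    \<comment> \<open>The duality lemma needs a linear map on a whole vector space, whereas
      \<open>u\<close> ranges over \<open>Rvec k\<close>. The map reads only the first
      \<open>k\<close> entries of \<open>u\<close>, so truncation restores membership without
      changing the slack.\<close>
    define cut :: "rvec \<Rightarrow> rvec" where "cut u = (\<lambda>i. if i < k then u i else 0)" for u
    have cut: "\<Phi> y s (cut u) = \<Phi> y s u" "cut u \<in> Rvec k" for y s u
      by (auto simp: \<Phi>_def mat_mult_def cut_def mem_Rvec)
    have "\<exists>lam\<in>dual_cone m K. (\<forall>v. dotp m lam (B v) = - c v) \<and> dotp m lam a \<le> - (f x - F x \<bullet> x)"
    proof (rule conic_strong_duality)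
      show "linear B"
        by (rule linearI) (auto simp: B_def \<Phi>_def rows_mult_def mat_mult_def fun_eq_iff
            inner_add_right sum.distrib sum_distrib_left algebra_simps)
      show "linear c"
        by (rule linearI) (auto simp: c_def inner_add_right algebra_simps)
      show "convex_cone K" using reg by (simp add: regular_cone_def)
      show "K \<subseteq> Rvec m" using reg by (rule regular_cone_subset_Rvec)
      show "B v \<in> Rvec m" for v
        using p by (auto simp: B_def \<Phi>_def rows_mult_def mat_mult_def mem_Rvec)
      show "a \<in> Rvec m" by (rule a)
      show "ess_strictly_feasible m K UNIV B a"
        using assms(11) unfolding ess_strictly_feasible_def B_def \<Phi>_def by (auto simp: case_prod_beta) metis
      \<comment> \<open>The tangent inequality at \<open>x\<close> bounds the objective over the
        epigraph: \<open>s \<ge> f y \<ge> f x + F x \<bullet> (y - x)\<close>.\<close>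
      fix v assume "cone_le K (B v) a"
      then have "cone_le K (\<Phi> (fst v) (fst (snd v)) (cut (snd (snd v)))) a"
        by (simp add: B_def cut)
      then have "fst v \<in> X" "f (fst v) \<le> fst (snd v)" using epi cut by blast+
      with tangent[OF x this(1)] show "f x - F x \<bullet> x \<le> c v"
        by (simp add: c_def inner_diff_right)
    qed
    then obtain lam where lam: "lam \<in> dual_cone m K" "\<And>v. dotp m lam (B v) = - c v"
      "dotp m lam a \<le> - (f x - F x \<bullet> x)" by blast
    \<comment> \<open>Two linear forms in \<open>(y, s, u)\<close> agree; separating the variables
      yields the three dual equalities.\<close>
    have eq: "rows_tmult m A lam \<bullet> y + s * dotp m p lam + dotp k (mat_tmult m k Q lam) u = F x \<bullet> y - s" for y s u
      using lam(2)[of "(y, s, u)"] by (simp add: B_def c_def pair)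
    have 1: "rows_tmult m A lam = F x"
      using eq[of _ 0 0] by (intro vector_eq_rdot[THEN iffD1]) simp
    have 2: "dotp m p lam = -1"
      using eq[of 0 1 0] by simp
    have 3: "mat_tmult m k Q lam = 0"
    proof
      fix i
      have "dotp k (mat_tmult m k Q lam) (\<lambda>j. if j = i then 1 else 0) = 0"
        using eq[of 0 0] by simp
      then have "i < k \<Longrightarrow> mat_tmult m k Q lam i = 0"
        by (simp add: dotp_def if_distrib cong: if_cong)
      then show "mat_tmult m k Q lam i = 0 i"
        by (cases "i < k") (auto simp: mat_tmult_def mat_mult_def)
    qed
    obtain u where u: "u \<in> Rvec k" "cone_le K (\<Phi> x (f x) u) a"
      using epi[of x "f x"] x by blast
    show ?thesis
      \<comment> \<open>With \<open>s = f x\<close> and \<open>r = F x \<bullet> x - f x\<close> the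
        sum \<open>s + r\<close> is exactly \<open>F x \<bullet> x\<close>, and the duality bound on
        \<open>dotp m lam a\<close> is the constraint on \<open>r\<close>.\<close>
      unfolding TT using 1 2 3 u lam
      by (intro exI[of _ "f x"] exI[of _ "F x \<bullet> x - f x"] exI[of _ lam] exI[of _ u])
        (auto simp: dual_cone_def dotp_commute[of m lam a])
  qed
  moreover have "monotone_field X F"
    unfolding monotone_field_def
  proof (intro ballI)
    fix x y assume "x \<in> X" "y \<in> X"
    from tangent[OF this] tangent[OF this(2,1)]
    show "0 \<le> (F x - F y) \<bullet> (x - y)"
      by (simp add: inner_diff_left inner_diff_right)
  qed
  moreover have "conic_constraint_set KK (1 + (1 + (m + k))) S"
    unfolding S_def \<Phi>_def by (rule conic_constraint_set_primal_dual[OF KK K a p])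
  moreover have "continuous_on X F"
    using assms(6) by (simp add: gradient_field_def)
  ultimately have "K_representation KK (1 + (1 + (m + k))) S F X"
    unfolding K_representation_def Let_def TT_def[symmetric] using assms(2,3) by blast
  then show ?thesis unfolding S_def \<Phi>_def .
qed

end
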